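(* Let $H$ be an abelian generalized subgroup of a non-abelian generalized group $G$ such that $G$ has the cancellation law, and let $A=H\times G$. For $(h_1,g_1),(h_2,g_2)\in A$, define $$(h_1,g_1)\circ(h_2,g_2)=(h_1h_2,\;h_2g_1h_2^{-1}g_2).$$ Then $(A,\circ)$ is a Bol quasigroup with a left identity element.
   Context: A generalized group is a non-empty set $G$ with a binary operation (written multiplicatively) such that: (i) $(xy)z=x(yz)$ for all $x,y,z\in G$; (ii) for each $x\in G$ there exists a unique element $e(x)\in G$ such that $xe(x)=e(x)x=x$; (iii) for each $x\in G$ there exists $x^{-1}\in G$ such that $xx^{-1}=x^{-1}x=e(x)$. In a generalized group, the element $x^{-1}$ in (iii) is unique for each $x$. A generalized group is abelian if $xy=yx$ for all its elements $x,y$, and non-abelian otherwise. A generalized subgroup of $G$ is a non-empty subset of $G$ that is closed under the operation of $G$ and is itself a generalized group under that operation. The cancellation law: for all $x,y,z\in G$, $xy=xz$ implies $y=z$, and $yx=zx$ implies $y=z$. A groupoid is a non-empty set $L$ with a binary operation $\cdot$ such that $x\cdot y\in L$ for all $x,y\in L$; it is a quasigroup if for all $a,b\in L$ the equations $a\cdot x=b$ and $y\cdot a=b$ have unique solutions $x$ and $y$ in $L$, respectively. A Bol quasigroup is a quasigroup satisfying the Bol identity $((xy)z)y=x((yz)y)$ for all $x,y,z$. A left identity element of $(L,\cdot)$ is an element $e\in L$ with $e\cdot x=x$ for all $x\in L$. *)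

theory Defs
  imports Main
begin

locale groupoid =
  fixes L :: "'a set" and mult :: "'a \<Rightarrow> 'a \<Rightarrow> 'a" (infixl \<open>\<cdot>\<close> 70)
  assumes nonempty: "L \<noteq> {}"
    and closed: "\<lbrakk>x \<in> L; y \<in> L\<rbrakk> \<Longrightarrow> x \<cdot> y \<in> L"

locale quasigroup = groupoid +
  assumes left_division: "\<lbrakk>a \<in> L; b \<in> L\<rbrakk> \<Longrightarrow> \<exists>!x. x \<in> L \<and> a \<cdot> x = b"
    and right_division: "\<lbrakk>a \<in> L; b \<in> L\<rbrakk> \<Longrightarrow> \<exists>!y. y \<in> L \<and> y \<cdot> a = b"

locale bol_quasigroup = quasigroup +
  assumes bol: "\<lbrakk>x \<in> L; y \<in> L; z \<in> L\<rbrakk> \<Longrightarrow> ((x \<cdot> y) \<cdot> z) \<cdot> y = x \<cdot> ((y \<cdot> z) \<cdot> y)"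

definition left_identity :: "'a set \<Rightarrow> ('a \<Rightarrow> 'a \<Rightarrow> 'a) \<Rightarrow> 'a \<Rightarrow> bool" where
  "left_identity L mult e \<longleftrightarrow> e \<in> L \<and> (\<forall>x\<in>L. mult e x = x)"

text \<open>
  In a generalized group the two descriptions below determine \<open>e(x)\<close> and \<open>x\<^sup>-\<^sup>1\<close> uniquely:
  the first by axiom, the second as a consequence of the axioms.
\<close>

definition local_identity :: "'a set \<Rightarrow> ('a \<Rightarrow> 'a \<Rightarrow> 'a) \<Rightarrow> 'a \<Rightarrow> 'a" where
  "local_identity G mult x = (THE e. e \<in> G \<and> mult x e = x \<and> mult e x = x)"

definition gg_inverse :: "'a set \<Rightarrow> ('a \<Rightarrow> 'a \<Rightarrow> 'a) \<Rightarrow> 'a \<Rightarrow> 'a" where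
  "gg_inverse G mult x =
     (THE y. y \<in> G \<and> mult x y = local_identity G mult x \<and> mult y x = local_identity G mult x)"

locale generalized_group = groupoid G mult
  for G :: "'a set" and mult :: "'a \<Rightarrow> 'a \<Rightarrow> 'a" (infixl \<open>\<cdot>\<close> 70) +
  assumes assoc: "\<lbrakk>x \<in> G; y \<in> G; z \<in> G\<rbrakk> \<Longrightarrow> (x \<cdot> y) \<cdot> z = x \<cdot> (y \<cdot> z)"
    and ex1_identity: "x \<in> G \<Longrightarrow> \<exists>!e. e \<in> G \<and> x \<cdot> e = x \<and> e \<cdot> x = x"
    and ex_inverse: "x \<in> G \<Longrightarrow>
      \<exists>y\<in>G. x \<cdot> y = local_identity G (\<cdot>) x \<and> y \<cdot> x = local_identity G (\<cdot>) x"

definition abelian :: "'a set \<Rightarrow> ('a \<Rightarrow> 'a \<Rightarrow> 'a) \<Rightarrow> bool" where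
  "abelian G mult \<longleftrightarrow> (\<forall>x\<in>G. \<forall>y\<in>G. mult x y = mult y x)"

definition cancellation_law :: "'a set \<Rightarrow> ('a \<Rightarrow> 'a \<Rightarrow> 'a) \<Rightarrow> bool" where
  "cancellation_law G mult \<longleftrightarrow> (\<forall>x\<in>G. \<forall>y\<in>G. \<forall>z\<in>G.
     (mult x y = mult x z \<longrightarrow> y = z) \<and> (mult y x = mult z x \<longrightarrow> y = z))"

text \<open>Non-emptiness and closure of \<open>H\<close> are part of \<^const>\<open>generalized_group\<close>.\<close>

definition generalized_subgroup :: "'a set \<Rightarrow> 'a set \<Rightarrow> ('a \<Rightarrow> 'a \<Rightarrow> 'a) \<Rightarrow> bool" where
  "generalized_subgroup H G mult \<longleftrightarrow> H \<subseteq> G \<and> generalized_group H mult"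

text \<open>The inverse of \<open>h2\<close> is taken in \<open>G\<close>; it agrees with the one taken in \<open>H\<close>.\<close>

fun twisted_mult ::
  "'a set \<Rightarrow> ('a \<Rightarrow> 'a \<Rightarrow> 'a) \<Rightarrow> 'a \<times> 'a \<Rightarrow> 'a \<times> 'a \<Rightarrow> 'a \<times> 'a" where
  "twisted_mult G mult (h1, g1) (h2, g2) =
     (mult h1 h2, mult (mult (mult h2 g1) (gg_inverse G mult h2)) g2)"

end

theory Submission
  imports Defs "HOL-Algebra.Group"
begin

text \<open>
  A generalized group with cancellation is a group: from \<open>x e(x) y = x y\<close> and \<open>y e(x) x = y x\<close>
  each \<open>e(x)\<close> is a two-sided identity. Hence \<open>H\<close> is a subgroup, and the word
  \<open>h\<^sub>2 g\<^sub>1 h\<^sub>2\<^sup>-\<^sup>1 g\<^sub>2\<close> can be solved for \<open>g\<^sub>1\<close> and for \<open>g\<^sub>2\<close>. Both sides of the Bol identity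
  reduce to the same word in the group.
\<close>

text \<open>A generalized group has no distinguished unit, so the record takes one as the parameter
  \<open>u\<close>; a local identity will be supplied for it.\<close>

abbreviation group_of :: "'a set \<Rightarrow> ('a \<Rightarrow> 'a \<Rightarrow> 'a) \<Rightarrow> 'a \<Rightarrow> 'a monoid" where
  "group_of G f u \<equiv> \<lparr>carrier = G, mult = f, one = u\<rparr>"

context generalized_group
begin

lemma local_identity_props:
  assumes "x \<in> G"
  shows "local_identity G (\<cdot>) x \<in> G" "x \<cdot> local_identity G (\<cdot>) x = x"
    "local_identity G (\<cdot>) x \<cdot> x = x"
  using theI'[OF ex1_identity[OF assms]] by (auto simp: local_identity_def)

lemma local_identity_eqI:
  assumes "x \<in> G" "e \<in> G" "x \<cdot> e = x" "e \<cdot> x = x"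
  shows "local_identity G (\<cdot>) x = e"
  using ex1_identity[OF assms(1)] local_identity_props[OF assms(1)] assms by blast

lemma group_of_cancellation:
  assumes canc: "cancellation_law G (\<cdot>)" and u: "u \<in> G"
  shows "group (group_of G (\<cdot>) (local_identity G (\<cdot>) u))"
proof -
  let ?e = "local_identity G (\<cdot>) u"
  note e = local_identity_props[OF u]
  have left: "?e \<cdot> y = y" if "y \<in> G" for y
    using canc assoc[of u ?e y] e u that closed unfolding cancellation_law_def by metis
  have right: "y \<cdot> ?e = y" if "y \<in> G" for y
    using canc assoc[of y ?e u] e u that closed unfolding cancellation_law_def by metis
  \<comment> \<open>As \<open>?e\<close> fixes \<open>x\<close> on both sides, it is the local
    identity of \<open>x\<close>, so the inverse of \<open>x\<close> from the axioms is an inverse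
    with respect to \<open>?e\<close>.\<close>
  have "\<exists>y\<in>G. y \<cdot> x = ?e" if "x \<in> G" for x
    using ex_inverse[OF that] local_identity_eqI[OF that e(1)] left right that by metis
  then show ?thesis
    by (intro groupI) (auto simp: closed assoc e left)
qed

end

text \<open>In a group \<open>x e = x\<close> forces \<open>e\<close> to be the unit, so both
  descriptions by \<open>THE\<close> have exactly one solution: \<open>u\<close>, and then the group
  inverse.\<close>

lemma gg_inverse_eq_inv:
  assumes "group (group_of G f u)" and "x \<in> G"
  shows "gg_inverse G f x = inv\<^bsub>group_of G f u\<^esub> x"
proof -
  interpret group "group_of G f u" by fact
  have "local_identity G f x = u"
    unfolding local_identity_def using assms(2) r_one l_one one_closed r_cancel_one
    by (intro the_equality) auto
  then show ?thesis
    unfolding gg_inverse_def using assms(2) r_inv l_inv inv_closed inv_equality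
    by (intro the_equality) auto
qed

text \<open>A local identity taken in \<open>H\<close> still solves \<open>x e = x\<close> in the
  group, hence is \<open>u\<close>. Inverses in \<open>H\<close> are therefore group inverses, which
  puts the latter in \<open>H\<close>.\<close>

lemma generalized_subgroup_imp_subgroup:
  assumes "group (group_of G f u)" and "generalized_subgroup H G f"
  shows "subgroup H (group_of G f u)"
proof -
  interpret group "group_of G f u" by fact
  interpret H: generalized_group H f
    using assms(2) by (simp add: generalized_subgroup_def)
  have sub: "H \<subseteq> G"
    using assms(2) by (simp add: generalized_subgroup_def)
  have id: "local_identity H f x = u" if "x \<in> H" for x
    using H.local_identity_props[OF that] r_cancel_one[of x] that sub by auto
  have "inv\<^bsub>group_of G f u\<^esub> x \<in> H" if x: "x \<in> H" for x
    using H.ex_inverse[OF x] id[OF x] inv_equality x sub by fastforce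
  then show ?thesis
    using sub H.nonempty H.closed by (intro subgroupI) auto
qed

text \<open>The values of \<open>op\<close> are prescribed only on
  \<open>H \<times> carrier G\<close>, so that \<open>twisted_mult\<close> fits once
  \<open>gg_inverse\<close> is identified with the group inverse there.\<close>

lemma (in group) bol_quasigroup_twisted:
  fixes op :: "'a \<times> 'a \<Rightarrow> 'a \<times> 'a \<Rightarrow> 'a \<times> 'a"
  assumes "subgroup H G"
    and op: "\<And>h1 g1 h2 g2. \<lbrakk>h1 \<in> H; g1 \<in> carrier G; h2 \<in> H; g2 \<in> carrier G\<rbrakk>
      \<Longrightarrow> op (h1, g1) (h2, g2) = (h1 \<otimes> h2, h2 \<otimes> g1 \<otimes> inv h2 \<otimes> g2)"
  shows "bol_quasigroup (H \<times> carrier G) op"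
    and "left_identity (H \<times> carrier G) op (\<one>, \<one>)"
proof -
  interpret H: subgroup H G by fact
  note [simp] = H.mem_carrier
  have inv_cancel [simp]: "inv x \<otimes> (x \<otimes> y) = y" "x \<otimes> (inv x \<otimes> y) = y"
    if "x \<in> carrier G" "y \<in> carrier G" for x y
    using that by (simp_all flip: m_assoc)
  show "bol_quasigroup (H \<times> carrier G) op"
  proof
    show "H \<times> carrier G \<noteq> {}"
      using H.one_closed by blast
  next
    fix x y assume "x \<in> H \<times> carrier G" "y \<in> H \<times> carrier G"
    then show "op x y \<in> H \<times> carrier G"
      by (auto simp: op)
  next
    fix a b assume "a \<in> H \<times> carrier G" "b \<in> H \<times> carrier G"
    then obtain h g k l where ab: "a = (h, g)" "b = (k, l)"
      and in_H: "h \<in> H" "k \<in> H" and in_G: "g \<in> carrier G" "l \<in> carrier G"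
      by auto
    \<comment> \<open>\<open>?x\<close> solves the first coordinate \<open>h x = k\<close>. The
      second one then reads \<open>c g' = l\<close> with \<open>c\<close> the conjugate of
      \<open>g\<close> by \<open>?x\<close>, so \<open>g'\<close> is
      \<open>inv c \<otimes> l\<close>.\<close>
    let ?x = "inv h \<otimes> k"
    show "\<exists>!x. x \<in> H \<times> carrier G \<and> op a x = b"
    proof (rule ex1I)
      show "(?x, inv (?x \<otimes> g \<otimes> inv ?x) \<otimes> l) \<in> H \<times> carrier G \<and>
          op a (?x, inv (?x \<otimes> g \<otimes> inv ?x) \<otimes> l) = b"
        using in_H in_G by (simp add: ab op)
    next
      fix p assume "p \<in> H \<times> carrier G \<and> op a p = b"
      \<comment> \<open>The equation expresses \<open>k\<close> and \<open>l\<close> through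
        \<open>p\<close>; with these values the witness cancels down to \<open>p\<close>.\<close>
      then show "p = (?x, inv (?x \<otimes> g \<otimes> inv ?x) \<otimes> l)"
        using in_H in_G by (cases p) (auto simp: ab op)
    qed
    \<comment> \<open>Obtained by solving \<open>h y inv(h) g = l\<close> for
      \<open>y\<close>.\<close>
    let ?y = "inv h \<otimes> (l \<otimes> inv g \<otimes> h)"
    show "\<exists>!y. y \<in> H \<times> carrier G \<and> op y a = b"
    proof (rule ex1I)
      show "(k \<otimes> inv h, ?y) \<in> H \<times> carrier G \<and> op (k \<otimes> inv h, ?y) a = b"
        using in_H in_G by (simp add: ab op m_assoc)
    next
      fix p assume "p \<in> H \<times> carrier G \<and> op p a = b"
      then show "p = (k \<otimes> inv h, ?y)"
        using in_H in_G by (cases p) (auto simp: ab op m_assoc inv_mult_group)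
    qed
  next
    fix x y z
    assume "x \<in> H \<times> carrier G" "y \<in> H \<times> carrier G" "z \<in> H \<times> carrier G"
    \<comment> \<open>With \<open>h\<close>, \<open>k\<close> the first coordinates of
      \<open>y\<close>, \<open>z\<close>, the right side contains \<open>inv (h k h)\<close>
      followed by \<open>h k\<close>; this collapses to \<open>inv h\<close>, as on the
      left.\<close>
    then show "op (op (op x y) z) y = op x (op (op y z) y)"
      by (auto simp: op m_assoc inv_mult_group)
  qed
  show "left_identity (H \<times> carrier G) op (\<one>, \<one>)"
    by (auto simp: left_identity_def op)
qed

theorem corollary3p3:
  fixes G H :: "'a set" and mult :: "'a \<Rightarrow> 'a \<Rightarrow> 'a"
  assumes "generalized_group G mult"
    and "\<not> abelian G mult"
    and "cancellation_law G mult"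
    and "generalized_subgroup H G mult"
    and "abelian H mult"
  shows "bol_quasigroup (H \<times> G) (twisted_mult G mult) \<and>
    (\<exists>e. left_identity (H \<times> G) (twisted_mult G mult) e)"
proof -
  interpret GG: generalized_group G mult by fact
  obtain u where "u \<in> G"
    using GG.nonempty by blast
  then obtain v where grp: "group (group_of G mult v)"
    using GG.group_of_cancellation assms(3) by blast
  interpret group "group_of G mult v" by (fact grp)
  have H: "subgroup H (group_of G mult v)"
    using generalized_subgroup_imp_subgroup[OF grp assms(4)] .
  then have "H \<subseteq> G"
    using subgroup.subset by fastforce
  then show ?thesis
    using bol_quasigroup_twisted[OF H, of "twisted_mult G mult"] gg_inverse_eq_inv[OF grp]
    by fastforce
qed

end
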